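(* Let $a_{\mathcal{P}}=\{a_\lambda:\lambda\in\mathcal{P}\}$ be scalars indexed by partitions. Then $a_{\mathcal{P}}$ satisfies the (classical) Plücker relations if and only if for all partitions $\alpha,\beta\in\mathcal{P}$, $$\sum_{\substack{i,j\ge 1\\|\alpha^{(i)}|+|\beta^{(-j)}|=|\alpha |+|\beta |+1}}(-1)^{|\alpha|-|\alpha^{(i)}|+i+j}\,a_{\alpha^{(i)}}\, a_{\beta^{(-j)}}=0.$$ (That is, the system of equations displayed is a presentation of the Plücker relations.)
   Context: $\mathcal{P}$ is the set of all partitions, including the empty one $\varepsilon$; $|\lambda|$ is the size, $l(\lambda)$ the number of parts; partitions are padded with zeros as needed. Classical Plücker relations: for all $m\ge1$ and all $\alpha=(\alpha_1,\dots,\alpha_{m-1})$, $\beta=(\beta_1,\dots,\beta_{m+1})\in\mathcal{P}$ with $l(\alpha)\le m-1$, $l(\beta)\le m+1$, $$\sum_{k=0}^m(-1)^{k-m+1+\ell}\,a_{(\alpha_1-1,\ldots,\alpha_{\ell}-1,\beta_{k+1}-k+\ell+1,\alpha_{\ell +1}, \ldots ,\alpha_{m-1})}\, a_{(\beta_1+1,\ldots,\beta_k+1,\beta_{k+2},\ldots ,\beta_{m+1})} =0,$$ where for each $k$, $\ell=\ell(k)\in\{0,\dots,m-1\}$ is the (unique if it exists) index with $\alpha_{\ell}-1\ge\beta_{k+1}-k+\ell+1\ge\alpha_{\ell+1}$ (convention $\alpha_0=\infty$, $\alpha_m=-\infty$) and $\beta_{k+1}-k+\ell+1\ge0$; if no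 such $\ell$ exists the $k$th term is $0$. Codes: the code of $\lambda$ is the two-way infinite word in U, R (infinitely U to the left, infinitely R to the right) recording the lower-right boundary lattice path of the diagram of $\lambda$ (English convention, corner at origin). For $i\ge1$, $\alpha^{(i)}$ is the partition whose code is obtained by changing the $i$th R from the left into U (explicitly $\alpha^{(i)}=(\alpha_1-1,\dots,\alpha_j-1,i-1,\alpha_{j+1},\dots,\alpha_n)$ where $\alpha_j\ge i>\alpha_{j+1}$, $\alpha_0=\infty$, $\alpha_{n+1}=0$, $n=l(\alpha)$); $\beta^{(-j)}$ is the partition whose code is obtained by changing the $j$th U from the right into R (explicitly $\beta^{(-j)}=(\beta_1+1,\dots,\beta_{j-1}+1,\beta_{j+1},\beta_{j+2},\dots)$). *)

theory Defs
  imports Main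
begin

section \<open>Partitions\<close>

typedef int_partition = "{xs :: nat list. sorted_wrt (\<ge>) xs \<and> 0 \<notin> set xs}"
  by (rule exI[of _ "[]"]) simp

text \<open>Parts are numbered from 1, and padded with zeros.\<close>

definition part :: "int_partition \<Rightarrow> nat \<Rightarrow> nat" where
  "part p r = (if 1 \<le> r \<and> r \<le> length (Rep_int_partition p)
               then Rep_int_partition p ! (r - 1) else 0)"

definition psize :: "int_partition \<Rightarrow> nat" where
  "psize p = sum_list (Rep_int_partition p)"

definition num_parts :: "int_partition \<Rightarrow> nat" where
  "num_parts p = length (Rep_int_partition p)"

text \<open>A finite weakly decreasing sequence, possibly with trailing zeros, read as a partition.
  Only meaningful for weakly decreasing lists; see \<open>part_of_parts\<close>.\<close>

definition of_parts :: "nat list \<Rightarrow> int_partition" where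
  "of_parts xs = Abs_int_partition (filter (\<lambda>x. x \<noteq> 0) xs)"


section \<open>Codes\<close>

datatype step = StepU | StepR

text \<open>Walk along the lower-right boundary of the diagram (English convention), from far down the
  left axis to far right along the top axis. At a boundary point at distance \<open>x\<close> from the left
  axis and depth \<open>y\<close> below the top axis, every step, U or R, raises \<open>x - y\<close> by one; the step
  that leaves \<open>x - y = t\<close> is put at position \<open>t\<close>. The up-step at the end of row \<open>r\<close> goes
  from \<open>(p\<^sub>r, r)\<close> to \<open>(p\<^sub>r, r - 1)\<close>, so it is at position \<open>p\<^sub>r - r\<close>; rows beyond the last part
  give the U's on the left axis. All other steps are R.\<close>

definition code :: "int_partition \<Rightarrow> int \<Rightarrow> step" where
  "code p t = (if \<exists>r\<ge>1. t = int (part p r) - int r then StepU else StepR)"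

text \<open>Two-way infinite words have no origin: the numbering of positions is irrelevant.\<close>

definition same_word :: "(int \<Rightarrow> step) \<Rightarrow> (int \<Rightarrow> step) \<Rightarrow> bool" where
  "same_word v w \<longleftrightarrow> (\<exists>s. \<forall>t. w t = v (t + s))"

definition is_nth_R :: "(int \<Rightarrow> step) \<Rightarrow> nat \<Rightarrow> int \<Rightarrow> bool" where
  "is_nth_R w i t \<longleftrightarrow> w t = StepR \<and> card {q. q \<le> t \<and> w q = StepR} = i"

definition is_nth_U_from_right :: "(int \<Rightarrow> step) \<Rightarrow> nat \<Rightarrow> int \<Rightarrow> bool" where
  "is_nth_U_from_right w j t \<longleftrightarrow> w t = StepU \<and> card {q. t \<le> q \<and> w q = StepU} = j"

text \<open>\<open>R_to_U p i\<close> is $p^{(i)}$ and \<open>U_to_R p j\<close> is $p^{(-j)}$, for \<open>i, j \<ge> 1\<close>. A word is the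
  code of at most one partition (\<open>same_word_code_imp_eq\<close>). The explicit descriptions by parts are
  \<open>part_R_to_U\<close> and \<open>part_U_to_R\<close>.\<close>

definition R_to_U :: "int_partition \<Rightarrow> nat \<Rightarrow> int_partition" where
  "R_to_U p i = (THE q. \<exists>t. is_nth_R (code p) i t \<and> same_word ((code p)(t := StepU)) (code q))"

definition U_to_R :: "int_partition \<Rightarrow> nat \<Rightarrow> int_partition" where
  "U_to_R p j =
     (THE q. \<exists>t. is_nth_U_from_right (code p) j t \<and> same_word ((code p)(t := StepR)) (code q))"


section \<open>Pluecker relations\<close>

text \<open>$(-1)^e$; the exponents below are integers that may be negative.\<close>

definition sgn_pow :: "int \<Rightarrow> 'k::comm_ring_1" where
  "sgn_pow e = (if even e then 1 else - 1)"

definition inserted :: "int_partition \<Rightarrow> nat \<Rightarrow> nat \<Rightarrow> int" where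
  "inserted \<beta> k l = int (part \<beta> (k + 1)) - int k + int l + 1"

text \<open>\<open>l = 0\<close> and \<open>l + 1 = m\<close> are the conventions $\alpha_0=\infty$ and $\alpha_m=-\infty$.
  There is at most one such \<open>l\<close> (\<open>insertion_index_unique\<close>), and the sequences below are then
  weakly decreasing (\<open>sorted_left_parts\<close>, \<open>sorted_right_parts\<close>).\<close>

definition insertion_index ::
    "nat \<Rightarrow> int_partition \<Rightarrow> int_partition \<Rightarrow> nat \<Rightarrow> nat \<Rightarrow> bool" where
  "insertion_index m \<alpha> \<beta> k l \<longleftrightarrow> l < m
     \<and> (l = 0 \<or> int (part \<alpha> l) - 1 \<ge> inserted \<beta> k l)
     \<and> (l + 1 = m \<or> inserted \<beta> k l \<ge> int (part \<alpha> (l + 1)))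
     \<and> inserted \<beta> k l \<ge> 0"

definition left_parts :: "nat \<Rightarrow> int_partition \<Rightarrow> int_partition \<Rightarrow> nat \<Rightarrow> nat \<Rightarrow> nat list" where
  "left_parts m \<alpha> \<beta> k l =
     map (\<lambda>r. part \<alpha> r - 1) [1..<l+1] @ [nat (inserted \<beta> k l)] @ map (part \<alpha>) [l+1..<m]"

definition right_parts :: "nat \<Rightarrow> int_partition \<Rightarrow> nat \<Rightarrow> nat list" where
  "right_parts m \<beta> k = map (\<lambda>r. part \<beta> r + 1) [1..<k+1] @ map (part \<beta>) [k+2..<m+2]"

definition pluecker_term ::
    "(int_partition \<Rightarrow> 'k::comm_ring_1) \<Rightarrow> nat \<Rightarrow> int_partition \<Rightarrow> int_partition \<Rightarrow> nat \<Rightarrow> 'k" where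
  "pluecker_term a m \<alpha> \<beta> k =
     (if \<exists>l. insertion_index m \<alpha> \<beta> k l then
        (let l = (THE l. insertion_index m \<alpha> \<beta> k l) in
           sgn_pow (int k - int m + 1 + int l)
             * a (of_parts (left_parts m \<alpha> \<beta> k l)) * a (of_parts (right_parts m \<beta> k)))
      else 0)"

definition satisfies_pluecker :: "(int_partition \<Rightarrow> 'k::comm_ring_1) \<Rightarrow> bool" where
  "satisfies_pluecker a \<longleftrightarrow>
     (\<forall>m\<ge>1. \<forall>\<alpha> \<beta>. num_parts \<alpha> \<le> m - 1 \<and> num_parts \<beta> \<le> m + 1 \<longrightarrow>
        (\<Sum>k=0..m. pluecker_term a m \<alpha> \<beta> k) = 0)"


section \<open>Well-definedness and explicit formulas\<close>

subsection \<open>Parts\<close>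

lemma Rep_props: "sorted_wrt (\<ge>) (Rep_int_partition p)" "0 \<notin> set (Rep_int_partition p)"
  using Rep_int_partition[of p] by auto

lemma part_antimono:
  assumes "1 \<le> r" "r \<le> s" shows "part p s \<le> part p r"
proof (cases "r = s")
  case False
  with assms have "r - 1 < s - 1" by auto
  then show ?thesis
    using assms Rep_props(1)[of p] by (auto simp: part_def sorted_wrt_iff_nth_less)
qed simp

lemma part_eq_0_iff: "1 \<le> r \<Longrightarrow> part p r = 0 \<longleftrightarrow> num_parts p < r"
proof -
  assume "1 \<le> r"
  moreover have "Rep_int_partition p ! (r - 1) \<noteq> 0" if "r \<le> length (Rep_int_partition p)"
  proof -
    have "Rep_int_partition p ! (r - 1) \<in> set (Rep_int_partition p)"
      using that \<open>1 \<le> r\<close> by (intro nth_mem) auto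
    then show ?thesis using Rep_props(2)[of p] by metis
  qed
  ultimately show ?thesis by (auto simp: part_def num_parts_def)
qed

lemma part_beyond: "num_parts p < r \<Longrightarrow> part p r = 0"
  by (simp add: part_def num_parts_def)

lemma int_partition_eqI:
  assumes "\<And>r. 1 \<le> r \<Longrightarrow> part p r = part q r" shows "p = q"
proof -
  have "num_parts p < r \<longleftrightarrow> num_parts q < r" if "1 \<le> r" for r
    using assms that part_eq_0_iff by metis
  from this[of "Suc (num_parts p)"] this[of "Suc (num_parts q)"]
  have len: "length (Rep_int_partition p) = length (Rep_int_partition q)"
    by (auto simp: num_parts_def)
  have "Rep_int_partition p = Rep_int_partition q"
  proof (rule nth_equalityI[OF len])
    fix i assume "i < length (Rep_int_partition p)"
    then show "Rep_int_partition p ! i = Rep_int_partition q ! i"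
      using assms[of "Suc i"] len by (simp add: part_def)
  qed
  then show ?thesis by (simp add: Rep_int_partition_inject)
qed

lemma filter_nonzero_nth:
  fixes xs :: "nat list"
  assumes "sorted_wrt (\<ge>) xs"
  shows "(if i < length (filter (\<lambda>x. x \<noteq> 0) xs) then filter (\<lambda>x. x \<noteq> 0) xs ! i else 0)
       = (if i < length xs then xs ! i else 0)"
  using assms
proof (induction xs arbitrary: i)
  case (Cons x xs)
  show ?case
  proof (cases "x = 0")
    case True
    with Cons.prems have z: "\<forall>y\<in>set xs. y = 0" by auto
    then have "filter (\<lambda>x. x \<noteq> 0) (x # xs) = []" using True by (auto simp: filter_empty_conv)
    moreover have "(x # xs) ! i = 0" if "i < length (x # xs)"
      using nth_mem[OF that] z True by auto
    ultimately show ?thesis by (simp only: list.size) auto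
  next
    case False
    then show ?thesis using Cons.IH[of "i - 1"] Cons.prems by (cases i) auto
  qed
qed simp

lemma Rep_of_parts:
  assumes "sorted_wrt (\<ge>) xs"
  shows "Rep_int_partition (of_parts xs) = filter (\<lambda>x. x \<noteq> 0) xs"
  using assms by (simp add: of_parts_def Abs_int_partition_inverse sorted_wrt_filter)

lemma part_of_parts:
  assumes "sorted_wrt (\<ge>) xs"
  shows "part (of_parts xs) r = (if 1 \<le> r \<and> r \<le> length xs then xs ! (r - 1) else 0)"
  using filter_nonzero_nth[OF assms, of "r - 1"]
  by (cases r) (auto simp: part_def Rep_of_parts[OF assms] Suc_le_eq)

lemma psize_of_parts:
  assumes "sorted_wrt (\<ge>) xs" shows "psize (of_parts xs) = sum_list xs"
proof -
  have "sum_list (filter (\<lambda>x. x \<noteq> 0) xs) = sum_list xs" by (induction xs) auto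
  then show ?thesis by (simp add: psize_def Rep_of_parts[OF assms])
qed

lemma exists_partition:
  fixes f :: "nat \<Rightarrow> nat"
  assumes "\<And>r s. 1 \<le> r \<Longrightarrow> r \<le> s \<Longrightarrow> f s \<le> f r" "\<And>r. N < r \<Longrightarrow> f r = 0"
  obtains p where "\<And>r. 1 \<le> r \<Longrightarrow> part p r = f r"
proof
  fix r :: nat assume r: "1 \<le> r"
  have "sorted_wrt (\<ge>) (map f [1..<N+1])"
    using assms(1) by (auto simp: sorted_wrt_iff_nth_less simp del: upt_Suc)
  from part_of_parts[OF this, of r] r show "part (of_parts (map f [1..<N+1])) r = f r"
    using assms(2)[of r] by (auto simp del: upt_Suc)
qed

lemma psize_eq_sum:
  assumes "num_parts p \<le> N" shows "psize p = (\<Sum>r=1..N. part p r)"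
proof -
  have "(\<Sum>r=1..N. part p r) = (\<Sum>r=1..num_parts p. part p r)"
    using assms by (intro sum.mono_neutral_right) (auto simp: part_beyond)
  also have "\<dots> = (\<Sum>i<num_parts p. part p (Suc i))"
    by (rule sum.reindex_bij_witness[of _ Suc "\<lambda>r. r - 1"]) auto
  also have "\<dots> = psize p"
    by (simp add: psize_def num_parts_def part_def sum_list_sum_nth atLeast0LessThan)
  finally show ?thesis by simp
qed


subsection \<open>The insertion index and the index sequences\<close>

lemma insertion_index_unique:
  assumes "insertion_index m \<alpha> \<beta> k l" "insertion_index m \<alpha> \<beta> k l'"
  shows "l = l'"
proof -
  have False if "insertion_index m \<alpha> \<beta> k l" "insertion_index m \<alpha> \<beta> k l'" "l < l'" for l l'
  proof -
    have "part \<alpha> l' \<le> part \<alpha> (l + 1)" using that(3) by (intro part_antimono) auto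
    then show False using that by (auto simp: insertion_index_def inserted_def)
  qed
  then show ?thesis using assms by (metis linorder_neqE_nat)
qed

lemma sorted_map_part:
  assumes "1 \<le> i"
  shows "sorted_wrt (\<ge>) (map (part p) [i..<j])"
    and "sorted_wrt (\<ge>) (map (\<lambda>r. part p r - 1) [i..<j])"
    and "sorted_wrt (\<ge>) (map (\<lambda>r. part p r + 1) [i..<j])"
proof -
  have "part p s \<le> part p r" if "i \<le> r" "r \<le> s" for r s
    using assms that by (intro part_antimono) auto
  then show "sorted_wrt (\<ge>) (map (part p) [i..<j])"
    "sorted_wrt (\<ge>) (map (\<lambda>r. part p r - 1) [i..<j])"
    "sorted_wrt (\<ge>) (map (\<lambda>r. part p r + 1) [i..<j])"
    by (auto simp: sorted_wrt_iff_nth_less intro!: diff_le_mono simp del: upt_Suc)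
qed

lemma sorted_left_parts:
  assumes "insertion_index m \<alpha> \<beta> k l"
  shows "sorted_wrt (\<ge>) (left_parts m \<alpha> \<beta> k l)"
proof -
  let ?x = "nat (inserted \<beta> k l)"
  have up: "?x \<le> part \<alpha> r - 1" if "1 \<le> r" "r \<le> l" for r
    using part_antimono[OF that, of \<alpha>] assms that by (auto simp: insertion_index_def)
  have lo: "part \<alpha> r \<le> ?x" if "l + 1 \<le> r" "r < m" for r
    using part_antimono[OF _ that(1), of \<alpha>] assms that by (auto simp: insertion_index_def)
  show ?thesis
    unfolding left_parts_def sorted_wrt_append
    using sorted_map_part(2)[of 1 \<alpha> "l + 1"] sorted_map_part(1)[of "l + 1" \<alpha> m] up lo
    by (fastforce simp del: upt_Suc intro: order_trans)
qed

lemma sorted_right_parts: "sorted_wrt (\<ge>) (right_parts m \<beta> k)"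
proof -
  have "part \<beta> s \<le> part \<beta> r + 1" if "1 \<le> r" "r \<le> k" "k + 2 \<le> s" for r s
    using part_antimono[of r s \<beta>] that by auto
  then show ?thesis
    unfolding right_parts_def sorted_wrt_append
    using sorted_map_part(3)[of 1 \<beta> "k + 1"] sorted_map_part(1)[of "k + 2" \<beta> "m + 2"]
    by (fastforce simp del: upt_Suc)
qed


subsection \<open>Codes\<close>

definition ustep :: "int_partition \<Rightarrow> nat \<Rightarrow> int" where
  "ustep p r = int (part p r) - int r"

lemma code_eq_U: "code p t = StepU \<longleftrightarrow> (\<exists>r\<ge>1. t = ustep p r)"
  by (simp add: code_def ustep_def)

lemma code_eq_R: "code p t = StepR \<longleftrightarrow> (\<forall>r\<ge>1. t \<noteq> ustep p r)"
  by (simp add: code_def ustep_def)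

lemma code_ustep: "1 \<le> r \<Longrightarrow> code p (ustep p r) = StepU"
  by (auto simp: code_eq_U)

lemma ustep_less: "1 \<le> r \<Longrightarrow> r < s \<Longrightarrow> ustep p s < ustep p r"
  using part_antimono[of r s p] by (simp add: ustep_def)

lemma ustep_le_iff: "1 \<le> r \<Longrightarrow> 1 \<le> s \<Longrightarrow> ustep p r \<le> ustep p s \<longleftrightarrow> s \<le> r"
  using ustep_less[of r s p] ustep_less[of s r p] by (cases r s rule: linorder_cases) auto

lemma ustep_inj: "1 \<le> r \<Longrightarrow> 1 \<le> s \<Longrightarrow> ustep p r = ustep p s \<longleftrightarrow> r = s"
  using ustep_less[of r s p] ustep_less[of s r p] by (metis less_irrefl linorder_neqE_nat)

lemma card_U_from: 
  assumes "1 \<le> r" shows "card {q. ustep p r \<le> q \<and> code p q = StepU} = r"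
proof -
  have "{q. ustep p r \<le> q \<and> code p q = StepU} = ustep p ` {1..r}"
    using assms by (auto simp: code_eq_U ustep_le_iff)
  moreover have "inj_on (ustep p) {1..r}"
    by (auto simp: inj_on_def ustep_inj)
  ultimately show ?thesis by (simp add: card_image)
qed

lemma is_nth_U_from_right_code:
  assumes "1 \<le> j" shows "is_nth_U_from_right (code p) j t \<longleftrightarrow> t = ustep p j"
proof
  assume "is_nth_U_from_right (code p) j t"
  then obtain r where "1 \<le> r" "t = ustep p r" "card {q. t \<le> q \<and> code p q = StepU} = j"
    unfolding is_nth_U_from_right_def code_eq_U[of p t] by blast
  then show "t = ustep p j" using card_U_from[of r p] by simp
next
  assume "t = ustep p j"
  then show "is_nth_U_from_right (code p) j t"
    using assms card_U_from[of j p] code_ustep[of j p] by (simp add: is_nth_U_from_right_def)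
qed

lemma same_word_code_imp_eq:
  assumes "same_word (code p) (code q)" shows "p = q"
proof -
  obtain s where s: "\<And>t. code q t = code p (t + s)"
    using assms by (auto simp: same_word_def)
  have eq: "ustep p r = ustep q r + s" if r: "1 \<le> r" for r
  proof -
    have "{x. ustep q r + s \<le> x \<and> code p x = StepU}
        = (\<lambda>x. x + s) ` {x. ustep q r \<le> x \<and> code q x = StepU}"
      by (force simp: s intro: image_eqI[of _ _ "x - s" for x])
    then have "card {x. ustep q r + s \<le> x \<and> code p x = StepU} = r"
      using card_U_from[OF r] by (simp add: card_image)
    moreover have "code p (ustep q r + s) = StepU"
      using r by (auto simp: s[symmetric] code_eq_U)
    ultimately show ?thesis
      using is_nth_U_from_right_code[OF r, of p "ustep q r + s"]
      unfolding is_nth_U_from_right_def by metis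
  qed
  define r where "r = num_parts p + num_parts q + 1"
  have "s = 0" using eq[of r] by (simp add: r_def ustep_def part_beyond)
  then show ?thesis
    using eq by (intro int_partition_eqI) (simp add: ustep_def)
qed

lemma same_word_trans_left:
  "same_word v w \<Longrightarrow> same_word v u \<Longrightarrow> same_word w u"
proof -
  assume "same_word v w" "same_word v u"
  then obtain s s' where "\<forall>t. w t = v (t + s)" "\<forall>t. u t = v (t + s')"
    by (auto simp: same_word_def)
  then have "\<forall>t. u t = w (t + (s' - s))" by (simp add: algebra_simps)
  then show ?thesis unfolding same_word_def by blast
qed

text \<open>The length of column \<open>i\<close> of the diagram, i.e. the \<open>j\<close> with $p_j \ge i > p_{j+1}$.\<close>

definition num_ge :: "int_partition \<Rightarrow> nat \<Rightarrow> nat" where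
  "num_ge p i = card {r. 1 \<le> r \<and> i \<le> part p r}"

lemma num_ge_iff:
  assumes "1 \<le> i" "1 \<le> r" shows "i \<le> part p r \<longleftrightarrow> r \<le> num_ge p i"
proof -
  let ?S = "{r. 1 \<le> r \<and> i \<le> part p r}"
  have "?S \<subseteq> {1..num_parts p}"
    using assms by (auto simp: not_less[symmetric] part_eq_0_iff[symmetric])
  then have fin: "finite ?S" using finite_subset by blast
  show ?thesis
  proof
    assume "i \<le> part p r"
    then have "i \<le> part p x" if "1 \<le> x" "x \<le> r" for x
      using part_antimono[OF that, of p] by simp
    then have "{1..r} \<subseteq> ?S" by auto
    from card_mono[OF fin this] show "r \<le> num_ge p i" by (simp add: num_ge_def)
  next
    assume le: "r \<le> num_ge p i"
    show "i \<le> part p r"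
    proof (rule ccontr)
      assume n: "\<not> i \<le> part p r"
      have "x < r" if "x \<in> ?S" for x
        using part_antimono[of r x p] that n assms by (auto simp: not_less intro: leI)
      then have "?S \<subseteq> {1..r-1}" by fastforce
      then have "card ?S \<le> r - 1" using card_mono[of "{1..r-1}" ?S] by simp
      with le assms show False by (simp add: num_ge_def)
    qed
  qed
qed

lemma num_ge_le: "1 \<le> i \<Longrightarrow> num_ge p i \<le> num_parts p"
  using num_ge_iff[of i "Suc (num_parts p)" p] part_beyond[of p "Suc (num_parts p)"] by auto

lemma is_nth_R_code:
  assumes i: "1 \<le> i"
  shows "is_nth_R (code p) i t \<longleftrightarrow> t = int i - 1 - int (num_ge p i)"
proof -
  let ?l = "num_ge p i"
  let ?t = "int i - 1 - int ?l"
  let ?S = "\<lambda>t. {q. q \<le> t \<and> code p q = StepR}"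
  define N where "N = num_parts p + 1"
  have low: "code p q = StepU" if "q < - int N" for q
  proof -
    have "q = ustep p (nat (- q))" using that by (simp add: ustep_def N_def part_beyond)
    then show ?thesis using that by (auto simp: code_eq_U intro!: exI[of _ "nat (- q)"])
  qed
  then have "- int N \<le> q" if "code p q = StepR" for q
    using that by (metis not_less step.distinct(1))
  then have sub: "?S t \<subseteq> {- int N..t}" for t by auto
  then have fin: "finite (?S t)" for t by (rule finite_subset) simp
  have hi: "ustep p r > ?t" if "1 \<le> r" "r \<le> ?l" for r
    using num_ge_iff[OF i that(1), of p] that by (simp add: ustep_def)
  have lo: "ustep p r < ?t" if "?l < r" for r
    using num_ge_iff[OF i, of r p] that by (simp add: ustep_def)
  have R: "code p ?t = StepR"
    unfolding code_eq_R using hi lo by (metis less_irrefl not_le)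
  have lN: "?l \<le> N" using num_ge_le[OF i, of p] by (simp add: N_def)
  have "?S ?t = {- int N..?t} - ustep p ` {?l+1..N}"
  proof (intro set_eqI iffI)
    fix q assume q: "q \<in> ?S ?t"
    show "q \<in> {- int N..?t} - ustep p ` {?l+1..N}"
    proof (intro DiffI)
      show "q \<in> {- int N..?t}" using sub[of ?t] q by (rule subsetD)
      show "q \<notin> ustep p ` {?l+1..N}"
      proof
        assume "q \<in> ustep p ` {?l+1..N}"
        then obtain r where "r \<in> {?l+1..N}" "q = ustep p r" by blast
        then have "1 \<le> r" "q = ustep p r" by auto
        with code_ustep[of r p] q show False by simp
      qed
    qed
  next
    fix q assume q: "q \<in> {- int N..?t} - ustep p ` {?l+1..N}"
    have False if "code p q = StepU"
    proof -
      obtain r where r: "1 \<le> r" "q = ustep p r" using \<open>code p q = StepU\<close> by (auto simp: code_eq_U)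
      have "?l < r" using hi[of r] r q by (auto simp: not_le[symmetric])
      moreover have "r \<le> N"
      proof (rule ccontr)
        assume "\<not> r \<le> N"
        then have "ustep p r < - int N" by (simp add: ustep_def part_beyond N_def)
        with q r show False by auto
      qed
      ultimately show False using q r by auto
    qed
    then show "q \<in> ?S ?t" using q by (cases "code p q") auto
  qed
  moreover have "ustep p ` {?l+1..N} \<subseteq> {- int N..?t}"
  proof
    fix q assume "q \<in> ustep p ` {?l+1..N}"
    then obtain r where "q = ustep p r" "?l < r" "r \<le> N" by auto
    then show "q \<in> {- int N..?t}" using lo[of r] by (simp add: ustep_def)
  qed
  moreover have "card (ustep p ` {?l+1..N}) = N - ?l"
  proof -
    have "inj_on (ustep p) {?l+1..N}" by (auto simp: inj_on_def ustep_inj)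
    then show ?thesis by (simp add: card_image)
  qed
  moreover have "int (card {- int N..?t}) = ?t + int N + 1"
    using lN i by simp
  ultimately have c: "card (?S ?t) = i"
    using lN i by (simp add: card_Diff_subset)
  have mono: "card (?S t) \<noteq> card (?S u)" if "t < u" "code p u = StepR" for t u
  proof -
    have "u \<in> ?S u" "u \<notin> ?S t" "?S t \<subseteq> ?S u" using that by auto
    then have "?S t \<subset> ?S u" by blast
    from psubset_card_mono[OF fin this] show ?thesis by (rule less_imp_neq)
  qed
  show ?thesis
  proof
    assume "is_nth_R (code p) i t"
    then have "code p t = StepR" "card (?S t) = i" by (simp_all add: is_nth_R_def)
    then show "t = ?t"
      using mono[of t ?t] mono[of ?t t] c R by (metis linorder_neqE_linordered_idom)
  next
    assume "t = ?t"
    then show "is_nth_R (code p) i t" using R c unfolding is_nth_R_def by blast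
  qed
qed

lemma R_to_U_eqI:
  assumes i: "1 \<le> i"
    and q: "\<And>r. 1 \<le> r \<Longrightarrow> part q r = (if r \<le> num_ge p i then part p r - 1
              else if r = num_ge p i + 1 then i - 1 else part p (r - 1))"
  shows "R_to_U p i = q"
proof -
  let ?l = "num_ge p i"
  let ?t = "int i - 1 - int ?l"
  let ?w = "(code p)(?t := StepU)"
  have ge: "i \<le> part p r" if "1 \<le> r" "r \<le> ?l" for r using num_ge_iff[OF i, of r p] that by simp
  have a: "ustep q r + 1 = ustep p r" if "1 \<le> r" "r \<le> ?l" for r
    using q[of r] ge[of r] that i by (simp add: ustep_def of_nat_diff)
  have b: "ustep q (?l + 1) + 1 = ?t" using q[of "?l + 1"] i by (simp add: ustep_def of_nat_diff)
  have c: "ustep q (r + 1) + 1 = ustep p r" if "?l < r" for r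
    using q[of "r + 1"] that by (simp add: ustep_def)
  have "(\<exists>r\<ge>1. t = ustep q r) \<longleftrightarrow> t + 1 = ?t \<or> (\<exists>r\<ge>1. t + 1 = ustep p r)" for t
  proof
    assume "\<exists>r\<ge>1. t = ustep q r"
    then obtain r where r: "1 \<le> r" "t = ustep q r" by auto
    consider "r \<le> ?l" | "r = ?l + 1" | "?l + 1 < r" by linarith
    then show "t + 1 = ?t \<or> (\<exists>r\<ge>1. t + 1 = ustep p r)"
    proof cases
      case 1 then show ?thesis using a[of r] r by auto
    next
      case 2 then show ?thesis using b r by auto
    next
      case 3 then show ?thesis using c[of "r - 1"] r by (intro disjI2 exI[of _ "r - 1"]) auto
    qed
  next
    assume "t + 1 = ?t \<or> (\<exists>r\<ge>1. t + 1 = ustep p r)"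
    then show "\<exists>r\<ge>1. t = ustep q r"
    proof
      assume "t + 1 = ?t" then show ?thesis using b by (intro exI[of _ "?l + 1"]) auto
    next
      assume "\<exists>r\<ge>1. t + 1 = ustep p r"
      then obtain r where r: "1 \<le> r" "t + 1 = ustep p r" by auto
      show ?thesis
      proof (cases "r \<le> ?l")
        case True then show ?thesis using a[of r] r by (intro exI[of _ r]) auto
      next
        case False then show ?thesis using c[of r] r by (intro exI[of _ "r + 1"]) auto
      qed
    qed
  qed
  then have "code q t = ?w (t + 1)" for t
    using code_eq_U[of q t] code_eq_U[of p "t + 1"]
    by (cases "code q t"; cases "code p (t + 1)") auto
  then have w: "same_word ?w (code q)" unfolding same_word_def by blast
  show ?thesis unfolding R_to_U_def is_nth_R_code[OF i]
  proof (rule the_equality)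
    show "\<exists>t. t = ?t \<and> same_word ((code p)(t := StepU)) (code q)" using w by auto
  next
    fix q' assume "\<exists>t. t = ?t \<and> same_word ((code p)(t := StepU)) (code q')"
    then show "q' = q" using w same_word_trans_left same_word_code_imp_eq by blast
  qed
qed

lemma U_to_R_eqI:
  assumes j: "1 \<le> j"
    and q: "\<And>r. 1 \<le> r \<Longrightarrow> part q r = (if r < j then part p r + 1 else part p (r + 1))"
  shows "U_to_R p j = q"
proof -
  let ?w = "(code p)(ustep p j := StepR)"
  have a: "ustep q r - 1 = ustep p r" if "1 \<le> r" "r < j" for r
    using q[of r] that by (simp add: ustep_def)
  have c: "ustep q r - 1 = ustep p (r + 1)" if "j \<le> r" for r
    using q[of r] that j by (simp add: ustep_def)
  have "(\<exists>r\<ge>1. t = ustep q r) \<longleftrightarrow> t - 1 \<noteq> ustep p j \<and> (\<exists>r\<ge>1. t - 1 = ustep p r)" for t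
  proof
    assume "\<exists>r\<ge>1. t = ustep q r"
    then obtain r where r: "1 \<le> r" "t = ustep q r" by auto
    show "t - 1 \<noteq> ustep p j \<and> (\<exists>r\<ge>1. t - 1 = ustep p r)"
    proof (cases "r < j")
      case True then show ?thesis using a[of r] r j ustep_inj[of r j p] by auto
    next
      case False
      then show ?thesis using c[of r] r j ustep_inj[of "r + 1" j p]
        by (auto intro!: exI[of _ "r + 1"])
    qed
  next
    assume "t - 1 \<noteq> ustep p j \<and> (\<exists>r\<ge>1. t - 1 = ustep p r)"
    then obtain r where r: "1 \<le> r" "t - 1 = ustep p r" "r \<noteq> j" by auto
    show "\<exists>r\<ge>1. t = ustep q r"
    proof (cases "r < j")
      case True then show ?thesis using a[of r] r by (intro exI[of _ r]) auto
    next
      case False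
      then have "j \<le> r - 1" "r - 1 + 1 = r" using r j by auto
      with c[of "r - 1"] have "t = ustep q (r - 1)" using r by simp
      then show ?thesis using \<open>j \<le> r - 1\<close> j by (intro exI[of _ "r - 1"]) auto
    qed
  qed
  then have "code q t = ?w (t + (- 1))" for t
    using code_eq_U[of q t] code_eq_U[of p "t - 1"]
    by (cases "code q t"; cases "code p (t - 1)") auto
  then have w: "same_word ?w (code q)" unfolding same_word_def by blast
  show ?thesis unfolding U_to_R_def is_nth_U_from_right_code[OF j]
  proof (rule the_equality)
    show "\<exists>t. t = ustep p j \<and> same_word ((code p)(t := StepR)) (code q)" using w by auto
  next
    fix q' assume "\<exists>t. t = ustep p j \<and> same_word ((code p)(t := StepR)) (code q')"
    then show "q' = q" using w same_word_trans_left same_word_code_imp_eq by blast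
  qed
qed

lemma part_R_to_U:
  assumes i: "1 \<le> i" and r: "1 \<le> r"
  shows "part (R_to_U p i) r = (if r \<le> num_ge p i then part p r - 1
              else if r = num_ge p i + 1 then i - 1 else part p (r - 1))"
proof -
  let ?l = "num_ge p i"
  let ?f = "\<lambda>r. if r \<le> ?l then part p r - 1 else if r = ?l + 1 then i - 1 else part p (r - 1)"
  have "?f s \<le> ?f r" if rs: "1 \<le> r" "r \<le> s" for r s
  proof -
    have "part p s \<le> part p r" using rs by (intro part_antimono)
    moreover have "r \<le> ?l \<Longrightarrow> i \<le> part p r" using num_ge_iff[OF i rs(1)] by simp
    moreover have "?l + 1 < s \<Longrightarrow> part p (s - 1) < i" using num_ge_iff[OF i, of "s - 1" p] by (simp add: not_le[symmetric])
    moreover have "?l + 1 < r \<Longrightarrow> part p (s - 1) \<le> part p (r - 1)" using rs by (intro part_antimono) auto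
    ultimately show ?thesis using rs by auto
  qed
  moreover have "?f r = 0" if "num_parts p + 1 < r" for r
    using that num_ge_le[OF i, of p] by (auto simp: part_beyond)
  ultimately obtain q where q: "\<And>r. 1 \<le> r \<Longrightarrow> part q r = ?f r"
    using exists_partition[of ?f "num_parts p + 1"] by blast
  have "R_to_U p i = q" by (rule R_to_U_eqI[OF i]) (rule q)
  then show ?thesis using q[OF r] by simp
qed

lemma part_U_to_R:
  assumes j: "1 \<le> j" and r: "1 \<le> r"
  shows "part (U_to_R p j) r = (if r < j then part p r + 1 else part p (r + 1))"
proof -
  let ?f = "\<lambda>r. if r < j then part p r + 1 else part p (r + 1)"
  have "?f s \<le> ?f r" if rs: "1 \<le> r" "r \<le> s" for r s
    using rs part_antimono[of r s p] part_antimono[of "r + 1" "s + 1" p]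
      part_antimono[of r "s + 1" p] by auto
  moreover have "?f r = 0" if "num_parts p + j < r" for r
    using that by (auto simp: part_beyond)
  ultimately obtain q where q: "\<And>r. 1 \<le> r \<Longrightarrow> part q r = ?f r"
    using exists_partition[of ?f "num_parts p + j"] by blast
  have "U_to_R p j = q" by (rule U_to_R_eqI[OF j]) (rule q)
  then show ?thesis using q[OF r] by simp
qed

lemma psize_R_to_U:
  assumes i: "1 \<le> i"
  shows "psize (R_to_U p i) + num_ge p i + 1 = psize p + i"
proof -
  let ?l = "num_ge p i" and ?n = "num_parts p" and ?q = "R_to_U p i"
  have ln: "?l \<le> ?n" by (rule num_ge_le[OF i])
  have "part ?q (?n + 2) = 0" using part_R_to_U[OF i, of "?n + 2" p] ln by (simp add: part_beyond)
  then have "num_parts ?q \<le> ?n + 1" using part_eq_0_iff[of "?n + 2" ?q] by simp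
  then have "psize ?q = (\<Sum>r=1..?n+1. part ?q r)" by (rule psize_eq_sum)
  also have "{1..?n+1} = {1..?l} \<union> {?l+1} \<union> {?l+2..?n+1}" using ln by auto
  also have "(\<Sum>r\<in>{1..?l} \<union> {?l+1} \<union> {?l+2..?n+1}. part ?q r)
      = (\<Sum>r=1..?l. part ?q r) + part ?q (?l+1) + (\<Sum>r=?l+2..?n+1. part ?q r)"
    by (subst sum.union_disjoint; (subst sum.union_disjoint)?) auto
  also have "part ?q (?l + 1) = i - 1" using part_R_to_U[OF i, of "?l + 1" p] by simp
  also have "(\<Sum>r=?l+2..?n+1. part ?q r) = (\<Sum>r=?l+1..?n. part p r)"
    by (rule sum.reindex_bij_witness[of _ Suc "\<lambda>r. r - 1"]) (auto simp: part_R_to_U[OF i])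
  finally have 1: "psize ?q = (\<Sum>r=1..?l. part ?q r) + (i - 1) + (\<Sum>r=?l+1..?n. part p r)" .
  have "part ?q r + 1 = part p r" if "r \<in> {1..?l}" for r
    using that part_R_to_U[OF i, of r p] num_ge_iff[OF i, of r p] i by auto
  then have "(\<Sum>r=1..?l. part p r) = (\<Sum>r=1..?l. part ?q r + 1)" by (intro sum.cong) auto
  then have 2: "(\<Sum>r=1..?l. part p r) = (\<Sum>r=1..?l. part ?q r) + ?l"
    by (simp add: sum.distrib del: One_nat_def) 
  have "psize p = (\<Sum>r=1..?n. part p r)" by (rule psize_eq_sum) simp
  also have "{1..?n} = {1..?l} \<union> {?l+1..?n}" using ln by auto
  also have "(\<Sum>r\<in>{1..?l} \<union> {?l+1..?n}. part p r)
      = (\<Sum>r=1..?l. part p r) + (\<Sum>r=?l+1..?n. part p r)"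
    by (rule sum.union_disjoint) auto
  finally show ?thesis using 1 2 i by simp
qed

lemma psize_U_to_R:
  assumes j: "1 \<le> j"
  shows "psize (U_to_R p j) + part p j + 1 = psize p + j"
proof -
  let ?q = "U_to_R p j" and ?N = "num_parts p + j"
  have "part ?q (?N + 1) = 0" using part_U_to_R[OF j, of "?N + 1" p] by (simp add: part_beyond)
  then have "num_parts ?q \<le> ?N" using part_eq_0_iff[of "?N + 1" ?q] by simp
  then have "psize ?q = (\<Sum>r=1..?N. part ?q r)" by (rule psize_eq_sum)
  also have "{1..?N} = {1..<j} \<union> {j..?N}" using j by auto
  also have "(\<Sum>r\<in>{1..<j} \<union> {j..?N}. part ?q r)
      = (\<Sum>r\<in>{1..<j}. part ?q r) + (\<Sum>r=j..?N. part ?q r)"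
    by (rule sum.union_disjoint) auto
  also have "(\<Sum>r\<in>{1..<j}. part ?q r) = (\<Sum>r\<in>{1..<j}. part p r + 1)"
    by (rule sum.cong) (auto simp: part_U_to_R[OF j])
  also have "\<dots> = (\<Sum>r\<in>{1..<j}. part p r) + (j - 1)" by (simp add: sum.distrib del: One_nat_def)
  also have "(\<Sum>r=j..?N. part ?q r) = (\<Sum>r=j+1..?N+1. part p r)"
    by (rule sum.reindex_bij_witness[of _ "\<lambda>r. r - 1" Suc]) (use j in \<open>auto simp: part_U_to_R[OF j]\<close>)
  finally have 1: "psize ?q = (\<Sum>r\<in>{1..<j}. part p r) + (j - 1) + (\<Sum>r=j+1..?N+1. part p r)" .
  have "psize p = (\<Sum>r=1..?N+1. part p r)" by (rule psize_eq_sum) simp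
  also have "{1..?N+1} = {1..<j} \<union> {j} \<union> {j+1..?N+1}" using j by auto
  also have "(\<Sum>r\<in>{1..<j} \<union> {j} \<union> {j+1..?N+1}. part p r)
      = (\<Sum>r\<in>{1..<j}. part p r) + part p j + (\<Sum>r=j+1..?N+1. part p r)"
    by (subst sum.union_disjoint; (subst sum.union_disjoint)?) auto
  finally show ?thesis using 1 j by simp
qed

text \<open>The index set of the quadratic relation for a pair of partitions is finite.\<close>

lemma finite_index_pairs:
  "finite {(i, j). 1 \<le> i \<and> 1 \<le> j \<and>
     psize (R_to_U \<alpha> i) + psize (U_to_R \<beta> j) = psize \<alpha> + psize \<beta> + 1}"
  (is "finite ?P")
proof (rule finite_subset)
  let ?B = "num_parts \<alpha> + part \<beta> 1 + 3"
  show "?P \<subseteq> {..?B} \<times> {..?B}"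
  proof
    fix x assume "x \<in> ?P"
    then obtain i j where x: "x = (i, j)" "1 \<le> i" "1 \<le> j"
      "psize (R_to_U \<alpha> i) + psize (U_to_R \<beta> j) = psize \<alpha> + psize \<beta> + 1"
      by auto
    have "part \<beta> j \<le> part \<beta> 1" using x by (intro part_antimono) auto
    then show "x \<in> {..?B} \<times> {..?B}"
      using x psize_R_to_U[of i \<alpha>] psize_U_to_R[of j \<beta>] num_ge_le[of i \<alpha>] by simp
  qed
qed simp

end

theory Submission
  imports Defs
begin

text \<open>For \<open>m > l(\<alpha>)\<close> and \<open>m + 1 \<ge> l(\<beta>)\<close> the two sums agree term by term, up to the sign
  \<open>(-1)^(m+1)\<close>: the \<open>k\<close>th Pluecker term is the term \<open>j = k + 1\<close>, \<open>i = inserted + 1\<close> of the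
  quadratic relation. Both index conditions say that the code of \<open>\<alpha>\<close> has an R two places after the
  \<open>j\<close>th U from the right of \<open>\<beta>\<close>. There are no terms with \<open>j > m + 1\<close>, because the code of \<open>\<alpha>\<close> has
  only U's that far to the left.\<close>

lemma num_ge_eqI:
  assumes "1 \<le> i" "l = 0 \<or> i \<le> part p l" "part p (l + 1) < i"
  shows "num_ge p i = l"
  using assms num_ge_iff[of i l p] num_ge_iff[of i "l + 1" p] by (cases "l = 0") auto

text \<open>With \<open>i - 1\<close> as inserted part, the inequalities for \<open>l\<close> become
  \<alpha>_l \<ge> i > \<alpha>_(l+1), which is what \<open>num_ge \<alpha> i\<close> satisfies. For
  \<open>l + 1 = m\<close> the upper one holds because \<open>part \<alpha> m = 0\<close>.\<close>

lemma insertion_index_iff_num_ge: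
  assumes m: "num_parts \<alpha> < m" and i: "1 \<le> i"
  shows "insertion_index m \<alpha> \<beta> k l \<and> i = nat (inserted \<beta> k l) + 1 \<longleftrightarrow>
         l = num_ge \<alpha> i \<and> inserted \<beta> k l = int i - 1" (is "?L \<longleftrightarrow> ?R")
proof
  assume L: ?L
  \<comment> \<open>The clause \<open>inserted \<beta> k l \<ge> 0\<close> ensures that
    \<open>nat\<close> loses nothing.\<close>
  then have ins: "inserted \<beta> k l = int i - 1" by (auto simp: insertion_index_def)
  have "num_ge \<alpha> i = l"
  proof (rule num_ge_eqI[OF i])
    show "l = 0 \<or> i \<le> part \<alpha> l" using L ins by (auto simp: insertion_index_def)
    show "part \<alpha> (l + 1) < i"
    proof (cases "l + 1 = m")
      case True
      then show ?thesis using m i by (simp add: part_beyond)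
    next
      case False
      then show ?thesis using L ins by (auto simp: insertion_index_def)
    qed
  qed
  with ins show ?R by simp
next
  assume R: ?R
  have "l < m" using R m num_ge_le[OF i, of \<alpha>] by simp
  moreover have "l = 0 \<or> i \<le> part \<alpha> l" using R num_ge_iff[OF i, of l \<alpha>] by (cases "l = 0") auto
  moreover have "part \<alpha> (l + 1) < i" using R num_ge_iff[OF i, of "l + 1" \<alpha>] by simp
  ultimately show ?L using R i by (auto simp: insertion_index_def)
qed

text \<open>The two sizes change by \<open>i - 1 - num_ge \<alpha> i\<close> and by
  \<open>k - part \<beta> (k + 1)\<close>; setting the total to 1 and solving for
  \<open>i - 1\<close> gives the inserted part.\<close>

lemma psize_eq_iff_inserted:
  assumes "1 \<le> i"
  shows "psize (R_to_U \<alpha> i) + psize (U_to_R \<beta> (k + 1)) = psize \<alpha> + psize \<beta> + 1 \<longleftrightarrow>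
         inserted \<beta> k (num_ge \<alpha> i) = int i - 1"
  using psize_R_to_U[OF assms, of \<alpha>] psize_U_to_R[of "k + 1" \<beta>]
  by (auto simp: inserted_def)

text \<open>The list has \<open>m\<close> entries; row \<open>r > m\<close> of the right-hand side
  is \<open>part \<alpha> (r - 1)\<close>, which is 0 since
  \<open>num_parts \<alpha> < m\<close>.\<close>

lemma of_parts_left_parts:
  assumes m: "num_parts \<alpha> < m" and ins: "insertion_index m \<alpha> \<beta> k l"
  shows "of_parts (left_parts m \<alpha> \<beta> k l) = R_to_U \<alpha> (nat (inserted \<beta> k l) + 1)"
proof (rule R_to_U_eqI[symmetric])
  fix r :: nat assume r: "1 \<le> r"
  have l: "l = num_ge \<alpha> (nat (inserted \<beta> k l) + 1)" "l < m"
    using insertion_index_iff_num_ge[OF m, of "nat (inserted \<beta> k l) + 1" \<beta> k l] ins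
    by (auto simp: insertion_index_def)
  show "part (of_parts (left_parts m \<alpha> \<beta> k l)) r =
      (if r \<le> num_ge \<alpha> (nat (inserted \<beta> k l) + 1) then part \<alpha> r - 1
       else if r = num_ge \<alpha> (nat (inserted \<beta> k l) + 1) + 1 then nat (inserted \<beta> k l) + 1 - 1
       else part \<alpha> (r - 1))"
    unfolding part_of_parts[OF sorted_left_parts[OF ins]] l(1)[symmetric]
    using r l(2) m
    by (auto simp: left_parts_def nth_append nth_Cons' part_beyond Suc_diff_Suc numeral_2_eq_2 simp del: upt_Suc)
qed simp

text \<open>Here too the list has \<open>m\<close> entries, and for \<open>r > m\<close> the part
  \<open>part \<beta> (r + 1)\<close> lies beyond the last part of \<beta>.\<close>

lemma of_parts_right_parts:
  assumes "num_parts \<beta> \<le> m + 1" "k \<le> m"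
  shows "of_parts (right_parts m \<beta> k) = U_to_R \<beta> (k + 1)"
proof (rule U_to_R_eqI[symmetric])
  fix r :: nat assume r: "1 \<le> r"
  show "part (of_parts (right_parts m \<beta> k)) r =
      (if r < k + 1 then part \<beta> r + 1 else part \<beta> (r + 1))"
    unfolding part_of_parts[OF sorted_right_parts]
    using r assms by (auto simp: right_parts_def nth_append part_beyond simp del: upt_Suc)
qed simp

lemma sgn_pow_add: "sgn_pow (x + y) = sgn_pow x * (sgn_pow y :: 'k::comm_ring_1)"
  by (auto simp: sgn_pow_def)

lemma sgn_pow_mult_self: "sgn_pow x * sgn_pow x = (1 :: 'k::comm_ring_1)"
  by (simp add: sgn_pow_def)

lemma sgn_pow_cong: "even (x - y) \<Longrightarrow> sgn_pow x = (sgn_pow y :: 'k::comm_ring_1)"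
  by (simp add: sgn_pow_def)

lemma pluecker_term_eq:
  fixes a :: "int_partition \<Rightarrow> 'k::comm_ring_1"
  assumes m: "num_parts \<alpha> < m" and \<beta>: "num_parts \<beta> \<le> m + 1" and k: "k \<le> m"
    and i: "1 \<le> i" and ins: "inserted \<beta> k (num_ge \<alpha> i) = int i - 1"
  shows "pluecker_term a m \<alpha> \<beta> k = sgn_pow (int m + 1) *
    (sgn_pow (int (psize \<alpha>) - int (psize (R_to_U \<alpha> i)) + int i + int (k + 1))
       * a (R_to_U \<alpha> i) * a (U_to_R \<beta> (k + 1)))"
proof -
  let ?l = "num_ge \<alpha> i"
  have L: "insertion_index m \<alpha> \<beta> k ?l" and i': "nat (inserted \<beta> k ?l) + 1 = i"
    using insertion_index_iff_num_ge[OF m i, of \<beta> k ?l] ins by auto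
  then have the: "(THE l. insertion_index m \<alpha> \<beta> k l) = ?l"
    by (intro the_equality) (auto intro: insertion_index_unique)
  \<comment> \<open>After substituting the size of \<open>R_to_U \<alpha> i\<close>, the right
    exponent is \<open>m + k + num_ge \<alpha> i + 3\<close>, so the exponents differ by
    \<open>2 * m + 2\<close>.\<close>
  have "sgn_pow (int k - int m + 1 + int ?l)
      = (sgn_pow ((int m + 1) + (int (psize \<alpha>) - int (psize (R_to_U \<alpha> i)) + int i + int (k + 1))) :: 'k)"
  proof (rule sgn_pow_cong)
    have "int (psize (R_to_U \<alpha> i)) = int (psize \<alpha>) + int i - int ?l - 1"
      using psize_R_to_U[OF i, of \<alpha>] by simp
    then show "even (int k - int m + 1 + int ?l -
       (int m + 1 + (int (psize \<alpha>) - int (psize (R_to_U \<alpha> i)) + int i + int (k + 1))))"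
      by simp
  qed
  moreover have "pluecker_term a m \<alpha> \<beta> k = sgn_pow (int k - int m + 1 + int ?l)
      * a (R_to_U \<alpha> i) * a (U_to_R \<beta> (k + 1))"
    using L of_parts_left_parts[OF m L, unfolded i'] of_parts_right_parts[OF \<beta> k]
    by (auto simp: pluecker_term_def the Let_def)
  ultimately show ?thesis by (simp only: sgn_pow_add mult.assoc)
qed

lemma sum_pluecker_term:
  fixes a :: "int_partition \<Rightarrow> 'k::comm_ring_1"
  assumes m: "num_parts \<alpha> < m" and \<beta>: "num_parts \<beta> \<le> m + 1"
  shows "(\<Sum>k=0..m. pluecker_term a m \<alpha> \<beta> k) = sgn_pow (int m + 1) *
    (\<Sum>(i, j) \<in> {(i, j). 1 \<le> i \<and> 1 \<le> j \<and>
            psize (R_to_U \<alpha> i) + psize (U_to_R \<beta> j) = psize \<alpha> + psize \<beta> + 1}.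
          sgn_pow (int (psize \<alpha>) - int (psize (R_to_U \<alpha> i)) + int i + int j)
            * a (R_to_U \<alpha> i) * a (U_to_R \<beta> j))"
    (is "_ = _ * (\<Sum>(i, j) \<in> ?P. ?f i j)")
proof -
  \<comment> \<open>\<open>K\<close> collects the indices whose term is not 0 by default; only there
    does the \<open>THE\<close> in \<open>h\<close> denote an insertion index.\<close>
  define K where "K = {k \<in> {0..m}. \<exists>l. insertion_index m \<alpha> \<beta> k l}"
  define h where "h k = nat (inserted \<beta> k (THE l. insertion_index m \<alpha> \<beta> k l)) + 1" for k
  have h: "insertion_index m \<alpha> \<beta> k l \<Longrightarrow> h k = nat (inserted \<beta> k l) + 1" for k l
    unfolding h_def by (subst the_equality[of _ l]) (auto intro: insertion_index_unique)
  have hK: "inserted \<beta> k (num_ge \<alpha> (h k)) = int (h k) - 1" "1 \<le> h k" if k: "k \<in> K" for k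
  proof -
    show "1 \<le> h k" by (simp add: h_def)
    obtain l where "insertion_index m \<alpha> \<beta> k l" using k by (auto simp: K_def)
    with h[OF this] insertion_index_iff_num_ge[OF m \<open>1 \<le> h k\<close>, of \<beta> k l]
    show "inserted \<beta> k (num_ge \<alpha> (h k)) = int (h k) - 1" by metis
  qed
  \<comment> \<open>A pair in the index set is determined by \<open>j\<close>, so
    \<open>j - 1\<close> inverts the map from \<open>k\<close> to
    \<open>(h k, k + 1)\<close>.\<close>
  have P: "j - 1 \<in> K" "h (j - 1) = i" "j - 1 + 1 = j" if ij: "(i, j) \<in> ?P" for i j
  proof -
    from ij have i: "1 \<le> i" and j: "1 \<le> j" by auto
    then show jj: "j - 1 + 1 = j" by simp
    have ins: "inserted \<beta> (j - 1) (num_ge \<alpha> i) = int i - 1"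
      using ij psize_eq_iff_inserted[OF i, of \<alpha> \<beta> "j - 1"] by (simp only: jj) simp
    \<comment> \<open>Otherwise the inserted part is \<open>num_ge \<alpha> i - j + 2\<close>, at
      most \<open>(m - 1) - (m + 2) + 2 = -1\<close>, whereas it equals
      \<open>i - 1 \<ge> 0\<close>.\<close>
    have "j \<le> m + 1"
    proof (rule ccontr)
      assume n: "\<not> j \<le> m + 1"
      then have "part \<beta> j = 0" using \<beta> by (simp add: part_beyond)
      then show False using ins n m num_ge_le[OF i, of \<alpha>] i jj by (simp add: inserted_def)
    qed
    moreover have L: "insertion_index m \<alpha> \<beta> (j - 1) (num_ge \<alpha> i)"
      and "i = nat (inserted \<beta> (j - 1) (num_ge \<alpha> i)) + 1"
      using insertion_index_iff_num_ge[OF m i, of \<beta> "j - 1" "num_ge \<alpha> i"] ins by auto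
    ultimately show "j - 1 \<in> K" "h (j - 1) = i" using h[OF L] by (auto simp: K_def)
  qed
  have "(\<Sum>k=0..m. pluecker_term a m \<alpha> \<beta> k) = (\<Sum>k\<in>K. pluecker_term a m \<alpha> \<beta> k)"
    by (rule sum.mono_neutral_right) (auto simp: K_def pluecker_term_def)
  also have "\<dots> = (\<Sum>(i, j) \<in> ?P. sgn_pow (int m + 1) * ?f i j)"
  proof (rule sum.reindex_bij_witness[of _ "\<lambda>(i, j). j - 1" "\<lambda>k. (h k, k + 1)"])
    fix k assume k: "k \<in> K"
    show "(h k, k + 1) \<in> ?P"
      using hK[OF k] psize_eq_iff_inserted[OF hK(2)[OF k]] by simp
    have "k \<le> m" using k by (simp add: K_def)
    from pluecker_term_eq[OF m \<beta> this hK(2)[OF k] hK(1)[OF k], of a]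
    show "(case (h k, k + 1) of (i, j) \<Rightarrow> sgn_pow (int m + 1) * ?f i j) = pluecker_term a m \<alpha> \<beta> k"
      by simp
  qed (use P in auto)
  finally show ?thesis by (simp add: sum_distrib_left case_prod_unfold)
qed

theorem theorem4p1:
  fixes a :: "int_partition \<Rightarrow> 'k::comm_ring_1"
  shows "satisfies_pluecker a \<longleftrightarrow>
    (\<forall>\<alpha> \<beta>.
       (\<Sum>(i, j) \<in> {(i, j). 1 \<le> i \<and> 1 \<le> j \<and>
            psize (R_to_U \<alpha> i) + psize (U_to_R \<beta> j) = psize \<alpha> + psize \<beta> + 1}.
          sgn_pow (int (psize \<alpha>) - int (psize (R_to_U \<alpha> i)) + int i + int j)
            * a (R_to_U \<alpha> i) * a (U_to_R \<beta> j)) = 0)"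
    (is "_ \<longleftrightarrow> (\<forall>\<alpha> \<beta>. ?Q \<alpha> \<beta> = 0)")
proof
  assume a: "satisfies_pluecker a"
  show "\<forall>\<alpha> \<beta>. ?Q \<alpha> \<beta> = 0"
  proof (intro allI)
    fix \<alpha> \<beta>
    \<comment> \<open>Any \<open>m\<close> meeting both length bounds would do, since a change of
      \<open>m\<close> affects the sum only by a sign.\<close>
    define m where "m = num_parts \<alpha> + num_parts \<beta> + 1"
    have "(\<Sum>k=0..m. pluecker_term a m \<alpha> \<beta> k) = 0"
    proof -
      have "1 \<le> m" "num_parts \<alpha> \<le> m - 1 \<and> num_parts \<beta> \<le> m + 1" by (auto simp: m_def)
      with a show ?thesis unfolding satisfies_pluecker_def by blast
    qed
    then have "sgn_pow (int m + 1) * ?Q \<alpha> \<beta> = 0"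
      using sum_pluecker_term[of \<alpha> m \<beta> a] by (simp add: m_def)
    \<comment> \<open>The ring may have zero divisors, so the sign is removed by multiplying with it
      again, as it is its own inverse.\<close>
    then have "(sgn_pow (int m + 1) * sgn_pow (int m + 1)) * ?Q \<alpha> \<beta> = 0"
      by (simp only: mult.assoc mult_zero_right)
    then show "?Q \<alpha> \<beta> = 0" by (simp only: sgn_pow_mult_self mult_1_left)
  qed
next
  assume Q: "\<forall>\<alpha> \<beta>. ?Q \<alpha> \<beta> = 0"
  show "satisfies_pluecker a"
    unfolding satisfies_pluecker_def
  proof (intro allI impI)
    fix m :: nat and \<alpha> \<beta>
    assume "1 \<le> m" "num_parts \<alpha> \<le> m - 1 \<and> num_parts \<beta> \<le> m + 1"
    then have "num_parts \<alpha> < m" "num_parts \<beta> \<le> m + 1" by auto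
    from sum_pluecker_term[OF this, of a] Q
    show "(\<Sum>k=0..m. pluecker_term a m \<alpha> \<beta> k) = 0" by (simp only: mult_zero_right)
  qed
qed

end
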